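(* Let $F$ be a finite field and let the affine group $\mathcal{A}_F$ act by measure preserving transformations $(T_g)_{g\in\mathcal{A}_F}$ on a probability space $(\Omega,\mathcal{B},\mu)$. Then for each $B\in\mathcal{B}$ with $\mu(B)>\sqrt{6/|F|}$ there exists $u\in F^*$ such that $\mu(B\cap M_uA_{-u}B)>0$. Moreover, if the action is ergodic and $B,C\in\mathcal{B}$ satisfy $\mu(B)\mu(C)>6/|F^*|$, then there exists $u\in F^*$ such that $\mu(B\cap M_uA_{-u}C)>0$.
   Context: $F^*=F\setminus\{0\}$. $\mathcal{A}_F$ is the group of maps $x\mapsto ux+v$ ($u\in F^*$, $v\in F$) under composition; $A_v$ denotes $x\mapsto x+v$ and $M_u$ denotes $x\mapsto ux$. For $S\in\mathcal{B}$, $M_uA_{-u}S:=T_{M_u}T_{A_{-u}}S$, i.e. the image of $S$ under the transformation corresponding to $x\mapsto u(x-u)$. *)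

theory Defs
  imports "HOL-Probability.Probability" "HOL-Algebra.Group_Action"
begin

definition add_map :: "'f::field \<Rightarrow> 'f \<Rightarrow> 'f"
  where "add_map v = (\<lambda>x. x + v)"

definition mult_map :: "'f::field \<Rightarrow> 'f \<Rightarrow> 'f"
  where "mult_map u = (\<lambda>x. u * x)"

definition affine_group :: "('f::field \<Rightarrow> 'f) monoid"
  where "affine_group =
    \<lparr>carrier = {(\<lambda>x. u * x + v) | u v. u \<noteq> 0}, mult = (\<circ>), one = id\<rparr>"

lemma affine_groupI: "u \<noteq> 0 \<Longrightarrow> (\<lambda>x. u * x + v) \<in> carrier affine_group"
  by (auto simp: affine_group_def)

lemma affine_groupE:
  assumes "f \<in> carrier affine_group"
  obtains u v where "u \<noteq> 0" "f = (\<lambda>x. u * x + v)"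
  using assms by (auto simp: affine_group_def)

lemma add_map_in_affine_group: "add_map v \<in> carrier affine_group"
  using affine_groupI[of 1 v] by (simp add: add_map_def)

lemma mult_map_in_affine_group: "u \<noteq> 0 \<Longrightarrow> mult_map u \<in> carrier affine_group"
  using affine_groupI[of u 0] by (simp add: mult_map_def)

lemma group_affine_group: "group (affine_group :: ('f::field \<Rightarrow> 'f) monoid)"
proof (rule groupI)
  fix f g :: "'f \<Rightarrow> 'f"
  assume "f \<in> carrier affine_group" "g \<in> carrier affine_group"
  then obtain a b c d where f: "a \<noteq> 0" "f = (\<lambda>x. a * x + b)"
    and g: "c \<noteq> 0" "g = (\<lambda>x. c * x + d)"
    by (elim affine_groupE)
  have "f \<circ> g = (\<lambda>x. (a * c) * x + (a * d + b))"
    using f g by (simp add: algebra_simps fun_eq_iff)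
  then show "f \<otimes>\<^bsub>affine_group\<^esub> g \<in> carrier affine_group"
    using affine_groupI[of "a * c" "a * d + b"] f(1) g(1) by (simp add: affine_group_def)
next
  show "\<one>\<^bsub>affine_group\<^esub> \<in> carrier (affine_group :: ('f \<Rightarrow> 'f) monoid)"
    using affine_groupI[of "1::'f" 0] by (simp add: affine_group_def id_def)
next
  fix f :: "'f \<Rightarrow> 'f"
  assume "f \<in> carrier affine_group"
  then obtain a b where f: "a \<noteq> 0" "f = (\<lambda>x. a * x + b)"
    by (elim affine_groupE)
  let ?g = "\<lambda>x. inverse a * x + (- (inverse a * b))"
  have "?g \<in> carrier affine_group"
    using f(1) by (intro affine_groupI) simp
  moreover have "?g \<otimes>\<^bsub>affine_group\<^esub> f = \<one>\<^bsub>affine_group\<^esub>"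
    using f by (simp add: affine_group_def fun_eq_iff algebra_simps)
  ultimately show "\<exists>g\<in>carrier affine_group. g \<otimes>\<^bsub>affine_group\<^esub> f = \<one>\<^bsub>affine_group\<^esub>"
    by (intro bexI[of _ ?g])
qed (simp_all add: affine_group_def o_assoc)

definition measure_preserving_map :: "'a measure \<Rightarrow> ('a \<Rightarrow> 'a) \<Rightarrow> bool"
  where "measure_preserving_map M f \<longleftrightarrow>
    f \<in> measurable M M \<and>
    (\<forall>S\<in>sets M. emeasure M (f -` S \<inter> space M) = emeasure M S)"

text \<open>A genuine (everywhere defined) left action: the homomorphism into
  \<^term>\<open>BijGroup (space M)\<close> gives \<open>T (g \<circ> h) = T g \<circ> T h\<close> on \<^term>\<open>space M\<close>.
  Values of \<open>T g\<close> outside \<^term>\<open>space M\<close> are fixed to \<^term>\<open>undefined\<close>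
  by that group's extensionality convention.\<close>

definition measure_preserving_action ::
    "('g, 'b) monoid_scheme \<Rightarrow> 'a measure \<Rightarrow> ('g \<Rightarrow> 'a \<Rightarrow> 'a) \<Rightarrow> bool"
  where "measure_preserving_action G M T \<longleftrightarrow>
    group_action G (space M) T \<and>
    (\<forall>g\<in>carrier G. measure_preserving_map M (T g))"

text \<open>Ergodicity is stated with strictly invariant sets. For a finite (or countable)
  group this is equivalent to using sets invariant modulo null sets.\<close>

definition ergodic_action ::
    "('g, 'b) monoid_scheme \<Rightarrow> 'a measure \<Rightarrow> ('g \<Rightarrow> 'a \<Rightarrow> 'a) \<Rightarrow> bool"
  where "ergodic_action G M T \<longleftrightarrow>
    measure_preserving_action G M T \<and>
    (\<forall>S\<in>sets M. (\<forall>g\<in>carrier G. T g ` S = S) \<longrightarrow>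
      measure M S = 0 \<or> measure M S = 1)"

end

theory Submission
  imports Defs
begin

text \<open>Let \<open>q = |F|\<close> and split \<open>1\<^sub>C = p + f\<close>, where \<open>p\<close> averages \<open>1\<^sub>C\<close> over the translations.
  Normality of the translations gives \<open>M\<^sub>u A\<^sub>-\<^sub>u p = M\<^sub>u p\<close>, so the average over \<open>u\<close> of
  \<open>M\<^sub>u A\<^sub>-\<^sub>u p\<close> is the average of \<open>1\<^sub>C\<close> over the whole affine group; its correlation
  with \<open>1\<^sub>B\<close> is at least \<open>\<mu>(B) \<mu>(C)\<close> if \<open>B = C\<close> (Cauchy-Schwarz) or if the action is ergodic.
  For the mean-zero part, expanding the square gives
  \<open>\<parallel>\<Sum>\<^sub>u M\<^sub>u A\<^sub>-\<^sub>u f\<parallel>\<^sup>2 \<le> (3q - 5) \<parallel>f\<parallel>\<^sup>2 \<le> (3q - 5) \<mu>(C)\<close>.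
  If all intersections were null, Cauchy-Schwarz would yield
  \<open>(q - 1)\<^sup>2 \<mu>(B) \<mu>(C) \<le> 3q - 5\<close>, contradicting either hypothesis on the measures.\<close>

section \<open>Coordinates \<open>(u, v)\<close> on the affine group\<close>

definition affine_map :: "'f::field \<Rightarrow> 'f \<Rightarrow> 'f \<Rightarrow> 'f"
  where "affine_map u v = (\<lambda>x. u * x + v)"

lemma affine_map_comp: "affine_map u v \<circ> affine_map a b = affine_map (u * a) (u * b + v)"
  by (simp add: affine_map_def fun_eq_iff algebra_simps)

lemma affine_map_in_carrier [simp]: "u \<noteq> 0 \<Longrightarrow> affine_map u v \<in> carrier affine_group"
  unfolding affine_map_def by (rule affine_groupI)

lemma affine_map_id: "affine_map 1 0 = \<one>\<^bsub>affine_group\<^esub>"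
  by (simp add: affine_map_def affine_group_def fun_eq_iff)

lemma mult_map_eq: "mult_map u = affine_map u 0"
  by (simp add: mult_map_def affine_map_def)

lemma add_map_eq: "add_map v = affine_map 1 v"
  by (simp add: add_map_def affine_map_def)

lemma integral_measure_preserving_map:
  fixes f :: "'a \<Rightarrow> real"
  assumes "measure_preserving_map M t" and "f \<in> borel_measurable M"
  shows "(\<integral>x. f (t x) \<partial>M) = (\<integral>x. f x \<partial>M)"
proof -
  have t: "t \<in> measurable M M" "\<And>S. S \<in> sets M \<Longrightarrow> emeasure M (t -` S \<inter> space M) = emeasure M S"
    using assms(1) by (auto simp: measure_preserving_map_def)
  have "distr M M t = M"
    by (rule measure_eqI) (auto simp: emeasure_distr t)
  with integral_distr[OF t(1) assms(2)] show ?thesis by simp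
qed

section \<open>Reindexing and counting in a finite field\<close>

lemma sum_affine_reindex:
  fixes g :: "'f::{field,finite} \<Rightarrow> real"
  assumes "k \<noteq> 0"
  shows "(\<Sum>s\<in>UNIV. g (k * s + b)) = (\<Sum>s\<in>UNIV. g s)"
  by (rule sum.reindex_bij_witness[of _ "\<lambda>s. (s - b) / k" "\<lambda>s. k * s + b"])
    (use assms in \<open>auto simp: field_simps\<close>)

lemma sum_nonzero_mult_reindex:
  fixes g :: "'f::{field,finite} \<Rightarrow> real"
  assumes "k \<noteq> 0"
  shows "(\<Sum>s\<in>UNIV-{0}. g (k * s)) = (\<Sum>s\<in>UNIV-{0}. g s)"
  by (rule sum.reindex_bij_witness[of _ "\<lambda>s. s / k" "\<lambda>s. k * s"])
    (use assms in auto)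

lemma sum_nonzero_inverse_reindex:
  fixes g :: "'f::{field,finite} \<Rightarrow> real"
  shows "(\<Sum>s\<in>UNIV-{0}. g (inverse s)) = (\<Sum>s\<in>UNIV-{0}. g s)"
  by (rule sum.reindex_bij_witness[of _ inverse inverse]) auto

lemma card_nonzero: "real (card (UNIV - {0::'f::{field,finite}})) = real CARD('f) - 1"
proof -
  have "CARD('f) \<ge> 1" by (simp add: Suc_leI)
  then show ?thesis by (simp add: card_Diff_singleton of_nat_diff)
qed

lemma card_field_ge_2: "real CARD('f::{field,finite}) \<ge> 2"
proof -
  have "card {0, 1::'f} \<le> CARD('f)" by (intro card_mono) auto
  then show ?thesis by simp
qed

lemma card_square_roots_1: "card {w::'f::{field,finite}. w * w = 1} \<le> 2"
proof -
  have "{w::'f. w * w = 1} \<subseteq> {1, -1}" by (auto simp: square_eq_1_iff)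
  then have "card {w::'f. w * w = 1} \<le> card {1, -1::'f}" by (intro card_mono) auto
  \<comment> \<open>Only an inequality: in characteristic 2 the elements 1 and -1 coincide.\<close>
  also have "\<dots> \<le> 2" by (simp add: card_insert_if)
  finally show ?thesis .
qed

text \<open>Expanding the square of the sum over \<open>u\<close> of the translates by \<open>x/u + u\<close> produces the
  maps \<open>w x + u (1 - w\<^sup>2)\<close>. Unless \<open>w = \<plusminus>1\<close>, the translation part runs
  over all nonzero field elements, and such a sum collapses to one term.\<close>

lemma correlation_sum_bound:
  fixes \<phi> :: "'f::{field,finite} \<Rightarrow> 'f \<Rightarrow> real"
  assumes zero: "\<And>w. w \<noteq> 0 \<Longrightarrow> (\<Sum>s\<in>UNIV. \<phi> w s) = 0"
    and bound: "\<And>w s. w \<noteq> 0 \<Longrightarrow> \<bar>\<phi> w s\<bar> \<le> K"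
  shows "(\<Sum>u\<in>UNIV-{0}. \<Sum>v\<in>UNIV-{0}. \<phi> (inverse u * v) (inverse u * (- (v * v)) + u))
    \<le> (3 * real CARD('f) - 5) * K"
proof -
  have K: "K \<ge> 0" using bound[of 1 0] by simp
  have "(\<Sum>u\<in>UNIV-{0}. \<Sum>v\<in>UNIV-{0}. \<phi> (inverse u * v) (inverse u * (- (v * v)) + u))
      = (\<Sum>u\<in>UNIV-{0}. \<Sum>w\<in>UNIV-{0}. \<phi> w ((1 - w * w) * u))"
  proof (rule sum.cong[OF refl])
    fix u :: 'f assume u: "u \<in> UNIV - {0}"
    \<comment> \<open>Substituting \<open>v = u * w\<close> makes the linear part independent of
      \<open>u\<close> and the translation part linear in \<open>u\<close>.\<close>
    have "(\<Sum>v\<in>UNIV-{0}. \<phi> (inverse u * v) (inverse u * (- (v * v)) + u))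
       = (\<Sum>w\<in>UNIV-{0}. \<phi> (inverse u * (u * w)) (inverse u * (- ((u * w) * (u * w))) + u))"
      using u by (intro sum_nonzero_mult_reindex[symmetric]) auto
    also have "\<dots> = (\<Sum>w\<in>UNIV-{0}. \<phi> w ((1 - w * w) * u))"
    proof -
      have "inverse u * (u * w) = w" "inverse u * (- ((u * w) * (u * w))) + u = (1 - w * w) * u" for w
        using u by (auto simp: field_simps)
      then show ?thesis by (simp only:)
    qed
    finally show "(\<Sum>v\<in>UNIV-{0}. \<phi> (inverse u * v) (inverse u * (- (v * v)) + u))
       = (\<Sum>w\<in>UNIV-{0}. \<phi> w ((1 - w * w) * u))" .
  qed
  also have "\<dots> = (\<Sum>w\<in>UNIV-{0}. \<Sum>u\<in>UNIV-{0}. \<phi> w ((1 - w * w) * u))"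
    by (rule sum.swap)
  \<comment> \<open>Each \<open>w\<close> costs \<open>K\<close>; an exceptional \<open>w\<close>,
    for which all \<open>q - 1\<close> terms equal \<open>\<phi> w 0\<close>, costs
    \<open>(q - 2) * K\<close> more.\<close>
  also have "\<dots> \<le> (\<Sum>w\<in>UNIV-{0::'f}. K + (if w * w = 1 then (real CARD('f) - 2) * K else 0))"
  proof (rule sum_mono)
    fix w :: 'f assume w: "w \<in> UNIV - {0}"
    have b: "\<bar>\<phi> w 0\<bar> \<le> K" using bound w by auto
    show "(\<Sum>u\<in>UNIV-{0}. \<phi> w ((1 - w * w) * u))
        \<le> K + (if w * w = 1 then (real CARD('f) - 2) * K else 0)"
    proof (cases "w * w = 1")
      case True
      then have "(\<Sum>u\<in>UNIV-{0}. \<phi> w ((1 - w * w) * u)) = (real CARD('f) - 1) * \<phi> w 0"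
        using card_nonzero[where 'f='f] by simp
      also have "\<dots> \<le> (real CARD('f) - 1) * K"
        using b card_field_ge_2[where 'f='f] by (intro mult_left_mono) auto
      finally show ?thesis using True by (simp add: algebra_simps)
    next
      case False
      then have "(\<Sum>u\<in>UNIV-{0}. \<phi> w ((1 - w * w) * u)) = (\<Sum>s\<in>UNIV-{0}. \<phi> w s)"
        by (intro sum_nonzero_mult_reindex) auto
      \<comment> \<open>The sum over all \<open>s\<close> vanishes, so the nonzero \<open>s\<close>
        contribute minus the missing term.\<close>
      also have "\<dots> = - \<phi> w 0"
        using zero[of w] w by (simp add: sum_diff1)
      finally show ?thesis using b False by simp
    qed
  qed
  also have "\<dots> = (real CARD('f) - 1) * K
      + real (card {w::'f. w * w = 1}) * ((real CARD('f) - 2) * K)"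
  proof -
    have "(UNIV - {0}) \<inter> {w::'f. w * w = 1} = {w. w * w = 1}" by auto
    then show ?thesis
      using card_nonzero[where 'f='f] by (simp add: sum.distrib sum.If_cases)
  qed
  \<comment> \<open>This is the source of the constant:
    \<open>(q - 1) + 2 * (q - 2) = 3 * q - 5\<close>.\<close>
  also have "\<dots> \<le> (real CARD('f) - 1) * K + 2 * ((real CARD('f) - 2) * K)"
    using card_square_roots_1[where 'f='f] card_field_ge_2[where 'f='f] K
    by (intro add_left_mono mult_right_mono) auto
  finally show ?thesis by (simp add: algebra_simps)
qed

section \<open>The action and its effect on bounded functions\<close>

locale affine_action = prob_space M
  for M :: "'a measure" and T :: "('f::{field,finite} \<Rightarrow> 'f) \<Rightarrow> 'a \<Rightarrow> 'a" +
  assumes action: "measure_preserving_action affine_group M T"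
begin

text \<open>A class of integrable functions closed under products, averages and the action, so it
  settles all integrability conditions. The bound is restricted to \<open>space M\<close> because
  \<open>T g\<close> is \<open>undefined\<close> elsewhere.\<close>

definition bounded_rv :: "('a \<Rightarrow> real) \<Rightarrow> bool"
  where "bounded_rv f \<longleftrightarrow> f \<in> borel_measurable M \<and> (\<exists>K. \<forall>x\<in>space M. \<bar>f x\<bar> \<le> K)"

lemma group_action: "group_action affine_group (space M) T"
  using action by (simp add: measure_preserving_action_def)

lemma T_measure_preserving: "u \<noteq> 0 \<Longrightarrow> measure_preserving_map M (T (affine_map u v))"
  using action by (simp add: measure_preserving_action_def)

lemma T_measurable [measurable]: "u \<noteq> 0 \<Longrightarrow> T (affine_map u v) \<in> measurable M M"
  using T_measure_preserving by (auto simp: measure_preserving_map_def)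

lemma T_in_space: "u \<noteq> 0 \<Longrightarrow> x \<in> space M \<Longrightarrow> T (affine_map u v) x \<in> space M"
  by (rule measurable_space[OF T_measurable])

lemma T_comp:
  assumes "u \<noteq> 0" "a \<noteq> 0" "x \<in> space M"
  shows "T (affine_map u v) (T (affine_map a b) x) = T (affine_map (u * a) (u * b + v)) x"
proof -
  have "T (affine_map u v \<otimes>\<^bsub>affine_group\<^esub> affine_map a b) x = T (affine_map u v) (T (affine_map a b) x)"
    using assms by (intro group_action.composition_rule[OF group_action]) auto
  then show ?thesis by (simp add: affine_group_def affine_map_comp)
qed

lemma T_id: "x \<in> space M \<Longrightarrow> T (affine_map 1 0) x = x"
  unfolding affine_map_id
  using group_action.id_eq_one[OF group_action] by (metis restrict_apply')

lemma integral_T: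
  fixes f :: "'a \<Rightarrow> real"
  shows "u \<noteq> 0 \<Longrightarrow> f \<in> borel_measurable M \<Longrightarrow> (\<integral>x. f (T (affine_map u v) x) \<partial>M) = (\<integral>x. f x \<partial>M)"
  using integral_measure_preserving_map[OF T_measure_preserving] .

text \<open>The inverse of \<open>x \<mapsto> u * x + v\<close> has coordinates
  \<open>(1/u, -v/u)\<close>. Images occur in the theorem and in ergodicity; preimages suit
  measurability and indicators.\<close>

lemma T_image_eq_vimage:
  assumes "u \<noteq> 0" "S \<subseteq> space M"
  shows "T (affine_map u v) ` S = T (affine_map (inverse u) (- (inverse u * v))) -` S \<inter> space M"
proof -
  have 1: "T (affine_map (inverse u) (- (inverse u * v))) (T (affine_map u v) x) = x" if "x \<in> space M" for x
    using T_comp[of "inverse u" u x "- (inverse u * v)" v] assms that T_id by simp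
  have 2: "T (affine_map u v) (T (affine_map (inverse u) (- (inverse u * v))) x) = x" if "x \<in> space M" for x
    using T_comp[of u "inverse u" x v "- (inverse u * v)"] assms that T_id
    by (simp add: mult.assoc[symmetric])
  show ?thesis
  proof (intro equalityI subsetI)
    fix x assume "x \<in> T (affine_map u v) ` S"
    then show "x \<in> T (affine_map (inverse u) (- (inverse u * v))) -` S \<inter> space M"
      using 1 assms T_in_space by auto
  next
    fix x assume "x \<in> T (affine_map (inverse u) (- (inverse u * v))) -` S \<inter> space M"
    then show "x \<in> T (affine_map u v) ` S" using 2 by force
  qed
qed

lemma bounded_rv_measurable [measurable_dest]: "bounded_rv f \<Longrightarrow> f \<in> borel_measurable M"
  by (simp add: bounded_rv_def)

lemma bounded_rv_integrable: "bounded_rv f \<Longrightarrow> integrable M f"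
  unfolding bounded_rv_def by (auto intro!: integrable_const_bound AE_I2)

lemma bounded_rv_T:
  assumes "u \<noteq> 0" "bounded_rv f"
  shows "bounded_rv (\<lambda>x. f (T (affine_map u v) x))"
proof -
  from assms obtain K where K: "\<And>x. x \<in> space M \<Longrightarrow> \<bar>f x\<bar> \<le> K" by (auto simp: bounded_rv_def)
  have "(\<lambda>x. f (T (affine_map u v) x)) \<in> borel_measurable M"
    by (rule measurable_compose[OF T_measurable]) (use assms in auto)
  with K show ?thesis unfolding bounded_rv_def using T_in_space assms by blast
qed

lemma bounded_rv_add:
  assumes "bounded_rv f" "bounded_rv g"
  shows "bounded_rv (\<lambda>x. f x + g x)"
proof -
  have [measurable]: "f \<in> borel_measurable M" "g \<in> borel_measurable M" using assms by auto
  from assms obtain K L where K: "\<And>x. x \<in> space M \<Longrightarrow> \<bar>f x\<bar> \<le> K"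
    "\<And>x. x \<in> space M \<Longrightarrow> \<bar>g x\<bar> \<le> L" by (auto simp: bounded_rv_def)
  have "\<bar>f x + g x\<bar> \<le> K + L" if "x \<in> space M" for x
    using K[OF that] by linarith
  moreover have "(\<lambda>x. f x + g x) \<in> borel_measurable M" by measurable
  ultimately show ?thesis unfolding bounded_rv_def by blast
qed

lemma bounded_rv_mult:
  assumes "bounded_rv f" "bounded_rv g"
  shows "bounded_rv (\<lambda>x. f x * g x)"
proof -
  have [measurable]: "f \<in> borel_measurable M" "g \<in> borel_measurable M" using assms by auto
  from assms obtain K L where K: "\<And>x. x \<in> space M \<Longrightarrow> \<bar>f x\<bar> \<le> K"
    "\<And>x. x \<in> space M \<Longrightarrow> \<bar>g x\<bar> \<le> L" by (auto simp: bounded_rv_def)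
  have "\<bar>f x * g x\<bar> \<le> K * L" if "x \<in> space M" for x
    unfolding abs_mult using K[OF that] by (intro mult_mono) auto
  moreover have "(\<lambda>x. f x * g x) \<in> borel_measurable M" by measurable
  ultimately show ?thesis unfolding bounded_rv_def by blast
qed

lemma bounded_rv_const: "bounded_rv (\<lambda>x. c)"
  by (auto simp: bounded_rv_def)

lemma bounded_rv_indicator: "B \<in> sets M \<Longrightarrow> bounded_rv (indicator B)"
  by (auto simp: bounded_rv_def indicator_def intro!: exI[of _ 1])

lemma bounded_rv_diff: "bounded_rv f \<Longrightarrow> bounded_rv g \<Longrightarrow> bounded_rv (\<lambda>x. f x - g x)"
  using bounded_rv_add[of f "\<lambda>x. (-1) * g x"] bounded_rv_mult[OF bounded_rv_const[of "-1"]] by simp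

lemma bounded_rv_divide: "bounded_rv f \<Longrightarrow> bounded_rv (\<lambda>x. f x / c)"
  using bounded_rv_mult[OF _ bounded_rv_const[of "inverse c"]] by (simp add: divide_inverse)

lemma bounded_rv_power2: "bounded_rv f \<Longrightarrow> bounded_rv (\<lambda>x. (f x)\<^sup>2)"
  unfolding power2_eq_square by (rule bounded_rv_mult)

lemma bounded_rv_sum: "(\<And>i. i \<in> I \<Longrightarrow> bounded_rv (f i)) \<Longrightarrow> bounded_rv (\<lambda>x. \<Sum>i\<in>I. f i x)"
  by (induction I rule: infinite_finite_induct) (auto intro: bounded_rv_const bounded_rv_add)

lemmas bounded_rv_intros = bounded_rv_T bounded_rv_add bounded_rv_mult bounded_rv_const
  bounded_rv_indicator bounded_rv_diff bounded_rv_divide bounded_rv_power2 bounded_rv_sum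

section \<open>The norm of a sum of translates of a mean-zero function\<close>

text \<open>By invariance of the measure, the inner product of two translates depends only on the
  quotient of the two group elements. The resulting correlations \<open>\<phi> w s\<close> sum to
  zero over \<open>s\<close>, so \<open>correlation_sum_bound\<close> applies.\<close>

lemma norm_sum_translates_le:
  assumes f: "bounded_rv f"
    and zero: "\<And>x. x \<in> space M \<Longrightarrow> (\<Sum>s\<in>UNIV. f (T (affine_map 1 s) x)) = 0"
  shows "(\<integral>x. (\<Sum>u\<in>UNIV-{0}. f (T (affine_map (inverse u) u) x))\<^sup>2 \<partial>M)
    \<le> (3 * real CARD('f) - 5) * (\<integral>x. (f x)\<^sup>2 \<partial>M)"
proof -
  define \<phi> where "\<phi> w s = (\<integral>x. f (T (affine_map w s) x) * f x \<partial>M)" for w s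
  have corr: "(\<integral>x. f (T (affine_map (inverse u) u) x) * f (T (affine_map (inverse v) v) x) \<partial>M)
      = \<phi> (inverse u * v) (inverse u * (- (v * v)) + u)" if "u \<noteq> 0" "v \<noteq> 0" for u v
  proof -
    let ?F = "\<lambda>x. f (T (affine_map (inverse u) u) x) * f (T (affine_map (inverse v) v) x)"
    have F: "bounded_rv ?F" using that f by (intro bounded_rv_intros) auto
    \<comment> \<open>The substituted map \<open>x \<mapsto> v * x - v * v\<close> is the inverse of
      \<open>x \<mapsto> x / v + v\<close>, so the second factor becomes \<open>f x\<close>.\<close>
    have "(\<integral>x. ?F x \<partial>M) = (\<integral>x. ?F (T (affine_map v (- (v * v))) x) \<partial>M)"
      using that F by (intro integral_T[symmetric]) auto
    also have "\<dots> = \<phi> (inverse u * v) (inverse u * (- (v * v)) + u)"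
      unfolding \<phi>_def
    proof (rule Bochner_Integration.integral_cong[OF refl])
      fix x assume "x \<in> space M"
      then show "?F (T (affine_map v (- (v * v))) x)
        = f (T (affine_map (inverse u * v) (inverse u * (- (v * v)) + u)) x) * f x"
        using that T_id by (simp add: T_comp mult.assoc[symmetric])
    qed
    finally show ?thesis .
  qed
  have "(\<integral>x. (\<Sum>u\<in>UNIV-{0}. f (T (affine_map (inverse u) u) x))\<^sup>2 \<partial>M)
    = (\<integral>x. (\<Sum>u\<in>UNIV-{0}. \<Sum>v\<in>UNIV-{0}.
        f (T (affine_map (inverse u) u) x) * f (T (affine_map (inverse v) v) x)) \<partial>M)"
    by (simp add: power2_eq_square sum_product)
  also have "\<dots> = (\<Sum>u\<in>UNIV-{0}. \<Sum>v\<in>UNIV-{0}.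
      \<integral>x. f (T (affine_map (inverse u) u) x) * f (T (affine_map (inverse v) v) x) \<partial>M)"
    using f by (subst Bochner_Integration.integral_sum,
        auto intro!: bounded_rv_integrable bounded_rv_intros sum.cong Bochner_Integration.integral_sum)
  also have "\<dots> = (\<Sum>u\<in>UNIV-{0}. \<Sum>v\<in>UNIV-{0}. \<phi> (inverse u * v) (inverse u * (- (v * v)) + u))"
    by (intro sum.cong refl corr) auto
  also have "\<dots> \<le> (3 * real CARD('f) - 5) * (\<integral>x. (f x)\<^sup>2 \<partial>M)"
  proof (rule correlation_sum_bound)
    fix w :: 'f assume w: "w \<noteq> 0"
    have "(\<Sum>s\<in>UNIV. \<phi> w s) = (\<integral>x. (\<Sum>s\<in>UNIV. f (T (affine_map w s) x) * f x) \<partial>M)"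
      unfolding \<phi>_def using f w
      by (intro Bochner_Integration.integral_sum[symmetric] bounded_rv_integrable bounded_rv_intros) auto
    also have "\<dots> = (\<integral>x. 0 \<partial>M)"
    proof (rule Bochner_Integration.integral_cong[OF refl])
      fix x assume x: "x \<in> space M"
      \<comment> \<open>The map \<open>w * x + s\<close> is multiplication by \<open>w\<close>
        followed by translation by \<open>s\<close>, so \<open>zero\<close> applies at the point
        moved by \<open>w\<close>.\<close>
      have "(\<Sum>s\<in>UNIV. f (T (affine_map w s) x)) = (\<Sum>s\<in>UNIV. f (T (affine_map 1 s) (T (affine_map w 0) x)))"
        using x w by (simp add: T_comp)
      also have "\<dots> = 0" using x w by (intro zero T_in_space)
      finally show "(\<Sum>s\<in>UNIV. f (T (affine_map w s) x) * f x) = 0"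
        by (simp add: sum_distrib_right[symmetric])
    qed
    finally show "(\<Sum>s\<in>UNIV. \<phi> w s) = 0" by simp
    fix s
    let ?g = "\<lambda>x. f (T (affine_map w s) x)"
    have sq: "(\<integral>x. (?g x)\<^sup>2 \<partial>M) = (\<integral>x. (f x)\<^sup>2 \<partial>M)"
      using f w by (intro integral_T[where f = "\<lambda>x. (f x)\<^sup>2"]) auto
    have i: "integrable M (\<lambda>x. (?g x)\<^sup>2)" "integrable M (\<lambda>x. (f x)\<^sup>2)" "integrable M (\<lambda>x. ?g x * f x)"
      using f w by (auto intro!: bounded_rv_integrable bounded_rv_intros)
    have "\<bar>\<phi> w s\<bar> \<le> (\<integral>x. \<bar>?g x * f x\<bar> \<partial>M)"
      unfolding \<phi>_def by (rule integral_abs_bound)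
    \<comment> \<open>Both factors have the same norm, so the pointwise bound
      \<open>|a * b| \<le> (a^2 + b^2) / 2\<close> does the work of Cauchy-Schwarz.\<close>
    also have "\<dots> \<le> (\<integral>x. ((?g x)\<^sup>2 + (f x)\<^sup>2) / 2 \<partial>M)"
    proof (rule integral_mono)
      fix x
      have "0 \<le> (\<bar>?g x\<bar> - \<bar>f x\<bar>)\<^sup>2" by simp
      then show "\<bar>?g x * f x\<bar> \<le> ((?g x)\<^sup>2 + (f x)\<^sup>2) / 2"
        by (simp add: power2_diff abs_mult)
    qed (use i in auto)
    also have "\<dots> = (\<integral>x. (f x)\<^sup>2 \<partial>M)" using i sq by simp
    finally show "\<bar>\<phi> w s\<bar> \<le> (\<integral>x. (f x)\<^sup>2 \<partial>M)" .
  qed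
  finally show ?thesis .
qed

section \<open>Averages over the translations and over the whole group\<close>

definition additive_average :: "('a \<Rightarrow> real) \<Rightarrow> 'a \<Rightarrow> real"
  where "additive_average f x = (\<Sum>s\<in>UNIV. f (T (affine_map 1 s) x)) / real CARD('f)"

text \<open>Each affine map is uniquely a multiplication followed by a translation, so this averages
  \<open>f\<close> over all \<open>q * (q - 1)\<close> group elements.\<close>

definition affine_average :: "('a \<Rightarrow> real) \<Rightarrow> 'a \<Rightarrow> real"
  where "affine_average f x =
    (\<Sum>u\<in>UNIV-{0}. additive_average f (T (affine_map u 0) x)) / (real CARD('f) - 1)"

lemma bounded_rv_additive_average: "bounded_rv f \<Longrightarrow> bounded_rv (additive_average f)"
  unfolding additive_average_def[abs_def] by (intro bounded_rv_intros) auto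

lemma bounded_rv_affine_average: "bounded_rv f \<Longrightarrow> bounded_rv (affine_average f)"
  unfolding affine_average_def[abs_def] using bounded_rv_additive_average
  by (intro bounded_rv_intros) auto

text \<open>The translation by \<open>v\<close> only shifts the summation index. This is what
  removes the \<open>A\<close>-part of \<open>M_u A_{-u}\<close> on the averaged component.\<close>

lemma additive_average_translate:
  assumes "x \<in> space M" "u \<noteq> 0"
  shows "additive_average f (T (affine_map u v) x) = additive_average f (T (affine_map u 0) x)"
proof -
  have "(\<Sum>s\<in>UNIV. f (T (affine_map u (v + s)) x)) = (\<Sum>s\<in>UNIV. f (T (affine_map u s) x))"
    using sum_affine_reindex[of 1 "\<lambda>s. f (T (affine_map u s) x)" v] by (simp add: add.commute)
  then show ?thesis using assms by (simp add: additive_average_def T_comp)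
qed

text \<open>Composing with \<open>a\<close> gives the map with coordinates
  \<open>(u * a, a * v)\<close>: the additive average absorbs \<open>a * v\<close>, and reindexing
  absorbs the factor \<open>u\<close>.\<close>

lemma affine_average_invariant:
  assumes "x \<in> space M" "u \<noteq> 0"
  shows "affine_average f (T (affine_map u v) x) = affine_average f x"
proof -
  have "(\<Sum>a\<in>UNIV-{0}. additive_average f (T (affine_map a 0) (T (affine_map u v) x)))
      = (\<Sum>a\<in>UNIV-{0}. additive_average f (T (affine_map (u * a) 0) x))"
  proof (rule sum.cong[OF refl])
    fix a :: 'f assume "a \<in> UNIV - {0}"
    then show "additive_average f (T (affine_map a 0) (T (affine_map u v) x))
      = additive_average f (T (affine_map (u * a) 0) x)"
      using assms additive_average_translate[of x "u * a" f "a * v"]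
      by (simp add: T_comp mult.commute)
  qed
  also have "\<dots> = (\<Sum>a\<in>UNIV-{0}. additive_average f (T (affine_map a 0) x))"
    using assms by (intro sum_nonzero_mult_reindex)
  finally show ?thesis by (simp add: affine_average_def)
qed

lemma integral_additive_average:
  assumes "bounded_rv f"
  shows "(\<integral>x. additive_average f x \<partial>M) = (\<integral>x. f x \<partial>M)"
proof -
  have "(\<integral>x. additive_average f x \<partial>M)
      = (\<Sum>s\<in>UNIV. \<integral>x. f (T (affine_map 1 s) x) \<partial>M) / real CARD('f)"
    unfolding additive_average_def using assms
    by (simp, subst Bochner_Integration.integral_sum) (auto intro!: bounded_rv_integrable bounded_rv_intros)
  also have "\<dots> = (\<integral>x. f x \<partial>M)" using assms by (simp add: integral_T bounded_rv_measurable)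
  finally show ?thesis .
qed

lemma integral_affine_average:
  assumes "bounded_rv f"
  shows "(\<integral>x. affine_average f x \<partial>M) = (\<integral>x. f x \<partial>M)"
proof -
  note a = bounded_rv_additive_average[OF assms]
  have "(\<integral>x. affine_average f x \<partial>M)
      = (\<Sum>u\<in>UNIV-{0}. \<integral>x. additive_average f (T (affine_map u 0) x) \<partial>M) / (real CARD('f) - 1)"
    unfolding affine_average_def using a
    by (simp, subst Bochner_Integration.integral_sum) (auto intro!: bounded_rv_integrable bounded_rv_intros)
  also have "(\<Sum>u\<in>UNIV-{0}. \<integral>x. additive_average f (T (affine_map u 0) x) \<partial>M)
      = (\<Sum>u\<in>UNIV-{0::'f}. \<integral>x. f x \<partial>M)"
    using a assms by (intro sum.cong) (auto simp: integral_T integral_additive_average)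
  finally show ?thesis
    using card_nonzero[where 'f='f] card_field_ge_2[where 'f='f] by simp
qed

text \<open>Along the translations of a point, subtracting the mean of the values cannot increase
  their sum of squares.\<close>

lemma norm_diff_additive_average_le:
  assumes f: "bounded_rv f"
  shows "(\<integral>x. (f x - additive_average f x)\<^sup>2 \<partial>M) \<le> (\<integral>x. (f x)\<^sup>2 \<partial>M)"
proof -
  let ?p = "additive_average f" and ?q = "real CARD('f)"
  note p = bounded_rv_additive_average[OF f]
  \<comment> \<open>The squares need not be comparable pointwise, but their additive averages are,
    and averaging preserves integrals.\<close>
  have 1: "additive_average (\<lambda>x. (f x - ?p x)\<^sup>2) x \<le> additive_average (\<lambda>x. (f x)\<^sup>2) x"
    if x: "x \<in> space M" for x
  proof -
    let ?a = "\<lambda>s. f (T (affine_map 1 s) x)"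
    have inv: "?p (T (affine_map 1 s) x) = ?p x" for s
      using additive_average_translate[OF x, of 1 f s] T_id[OF x] by simp
    have "(\<Sum>s\<in>UNIV. (?a s - ?p x)\<^sup>2) = (\<Sum>s\<in>UNIV. (?a s)\<^sup>2) - 2 * ?p x * (\<Sum>s\<in>UNIV. ?a s) + ?q * (?p x)\<^sup>2"
      by (simp add: power2_diff sum.distrib sum_subtractf sum_distrib_left mult_ac)
    also have "(\<Sum>s\<in>UNIV. ?a s) = ?q * ?p x" by (simp add: additive_average_def)
    finally have "(\<Sum>s\<in>UNIV. (?a s - ?p x)\<^sup>2) = (\<Sum>s\<in>UNIV. (?a s)\<^sup>2) - ?q * (?p x)\<^sup>2"
      by (simp add: power2_eq_square)
    also have "\<dots> \<le> (\<Sum>s\<in>UNIV. (?a s)\<^sup>2)" by simp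
    finally show ?thesis
      unfolding additive_average_def[of "\<lambda>x. (f x - ?p x)\<^sup>2"] additive_average_def[of "\<lambda>x. (f x)\<^sup>2"] inv
      by (intro divide_right_mono) auto
  qed
  have "(\<integral>x. additive_average (\<lambda>x. (f x - ?p x)\<^sup>2) x \<partial>M) \<le> (\<integral>x. additive_average (\<lambda>x. (f x)\<^sup>2) x \<partial>M)"
    using f p 1 by (intro integral_mono bounded_rv_integrable bounded_rv_additive_average bounded_rv_intros) auto
  then show ?thesis
    using f p by (simp add: integral_additive_average bounded_rv_intros)
qed

section \<open>The consequence of all intersections being null\<close>

lemma measure_intersection_eq:
  assumes "u \<noteq> 0" "B \<in> sets M" "C \<in> sets M"
  shows "measure M (B \<inter> T (mult_map u) ` (T (add_map (- u)) ` C))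
    = (\<integral>x. indicator B x * indicator C (T (affine_map (inverse u) u) x) \<partial>M)"
proof -
  let ?S = "T (affine_map (inverse u) u) -` C \<inter> space M"
  have C: "C \<subseteq> space M" using assms sets.sets_into_space by auto
  have "T (mult_map u) ` (T (add_map (- u)) ` C) = T (affine_map u (- (u * u))) ` C"
    unfolding mult_map_eq add_map_eq image_image
    using assms(1) C by (intro image_cong refl) (auto simp: T_comp)
  \<comment> \<open>The inverse of \<open>x \<mapsto> u * (x - u)\<close> is
    \<open>x \<mapsto> x / u + u\<close>.\<close>
  also have "\<dots> = ?S"
    using assms(1) C by (subst T_image_eq_vimage) (auto simp: mult.assoc[symmetric])
  finally have S: "T (mult_map u) ` (T (add_map (- u)) ` C) = ?S" .
  have "?S \<in> sets M" using assms by (intro measurable_sets[OF T_measurable]) auto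
  then have "measure M (B \<inter> ?S) = (\<integral>x. indicator (B \<inter> ?S) x \<partial>M)"
    using assms by simp
  also have "\<dots> = (\<integral>x. indicator B x * indicator C (T (affine_map (inverse u) u) x) \<partial>M)"
    by (intro Bochner_Integration.integral_cong) (auto simp: indicator_def)
  finally show ?thesis using S by simp
qed

text \<open>Null intersections force the sum \<open>D\<close> of the mean-zero parts to correlate
  very negatively with \<open>B\<close>, while its norm is small. Hypothesis \<open>avg\<close> is
  where the two claims of the theorem differ: it comes from \<open>B = C\<close> or from
  ergodicity.\<close>

lemma measure_prod_le_if_null_intersections:
  assumes B: "B \<in> sets M" and C: "C \<in> sets M"
    and null: "\<And>u. u \<noteq> 0 \<Longrightarrow>
      measure M (B \<inter> T (mult_map u) ` (T (add_map (- u)) ` C)) = 0"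
    and avg: "measure M B * measure M C \<le> (\<integral>x. indicator B x * affine_average (indicator C) x \<partial>M)"
  shows "(real CARD('f) - 1)\<^sup>2 * (measure M B * measure M C) \<le> 3 * real CARD('f) - 5"
\<comment> \<open>A null \<open>C\<close> is treated apart because a factor
  \<open>measure M C\<close> is cancelled at the end.\<close>
proof (cases "measure M C = 0")
  case True
  then show ?thesis using card_field_ge_2[where 'f='f] by simp
next
  case False
  let ?q = "real CARD('f)"
  let ?b = "indicator B :: 'a \<Rightarrow> real" and ?c = "indicator C :: 'a \<Rightarrow> real"
  let ?p = "additive_average ?c"
  let ?h = "\<lambda>u. T (affine_map (inverse u) u)"
  define f where "f x = ?c x - ?p x" for x
  define D where "D x = (\<Sum>u\<in>UNIV-{0}. f (?h u x))" for x
  \<comment> \<open>a multiplier for which \<open>\<parallel>D + t 1\<^sub>B\<parallel>\<^sup>2 \<ge> 0\<close> replaces the Cauchy-Schwarz inequality\<close>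
  define t where "t = (?q - 1) * measure M C"
  have pos: "measure M C > 0" using False by (simp add: zero_less_measure_iff)
  have q: "?q \<ge> 2" by (rule card_field_ge_2)
  have b: "bounded_rv ?b" and c: "bounded_rv ?c" using B C by (auto intro: bounded_rv_indicator)
  note p = bounded_rv_additive_average[OF c]
  have f: "bounded_rv f" unfolding f_def[abs_def] by (rule bounded_rv_diff[OF c p])
  have D: "bounded_rv D" unfolding D_def[abs_def] using f by (intro bounded_rv_intros) auto
  have f0: "(\<Sum>s\<in>UNIV. f (T (affine_map 1 s) x)) = 0" if x: "x \<in> space M" for x
  proof -
    have "?p (T (affine_map 1 s) x) = ?p x" for s
      using additive_average_translate[OF x, of 1 ?c s] T_id[OF x] by simp
    then show ?thesis by (simp add: f_def sum_subtractf) (simp add: additive_average_def)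
  qed
  have "(\<integral>x. (D x)\<^sup>2 \<partial>M) \<le> (3 * ?q - 5) * (\<integral>x. (f x)\<^sup>2 \<partial>M)"
    unfolding D_def using f f0 by (rule norm_sum_translates_le)
  also have "\<dots> \<le> (3 * ?q - 5) * measure M C"
  proof (rule mult_left_mono)
    have "(\<integral>x. (f x)\<^sup>2 \<partial>M) \<le> (\<integral>x. (?c x)\<^sup>2 \<partial>M)"
      unfolding f_def by (rule norm_diff_additive_average_le[OF c])
    also have "\<dots> = measure M C"
      using C by (simp add: power2_eq_square indicator_inter_arith[symmetric])
    finally show "(\<integral>x. (f x)\<^sup>2 \<partial>M) \<le> measure M C" .
  qed (use q in simp)
  finally have DD: "(\<integral>x. (D x)\<^sup>2 \<partial>M) \<le> (3 * ?q - 5) * measure M C" .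
  have "(\<integral>x. ?b x * D x \<partial>M)
    = (\<integral>x. (\<Sum>u\<in>UNIV-{0}. ?b x * ?c (?h u x)) - (?q - 1) * (?b x * affine_average ?c x) \<partial>M)"
  proof (rule Bochner_Integration.integral_cong[OF refl])
    fix x assume x: "x \<in> space M"
    \<comment> \<open>The translation part of \<open>?h u\<close> is absorbed by \<open>?p\<close>;
      then \<open>u \<mapsto> 1/u\<close> turns the sum into the affine average.\<close>
    have "(\<Sum>u\<in>UNIV-{0}. ?p (?h u x)) = (\<Sum>u\<in>UNIV-{0}. ?p (T (affine_map (inverse u) 0) x))"
      using x by (intro sum.cong refl additive_average_translate) auto
    also have "\<dots> = (?q - 1) * affine_average ?c x"
      using q sum_nonzero_inverse_reindex[of "\<lambda>u. ?p (T (affine_map u 0) x)"]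
      by (simp add: affine_average_def)
    finally show "?b x * D x
        = (\<Sum>u\<in>UNIV-{0}. ?b x * ?c (?h u x)) - (?q - 1) * (?b x * affine_average ?c x)"
      by (simp add: D_def f_def sum_subtractf sum_distrib_left[symmetric] right_diff_distrib)
  qed
  also have "\<dots> = (\<Sum>u\<in>UNIV-{0}. \<integral>x. ?b x * ?c (?h u x) \<partial>M)
      - (?q - 1) * (\<integral>x. ?b x * affine_average ?c x \<partial>M)"
  proof -
    have "bounded_rv (\<lambda>x. ?b x * ?c (?h u x))" if "u \<in> UNIV - {0}" for u
      using b c that by (intro bounded_rv_mult bounded_rv_T) auto
    note int = this bounded_rv_sum[of "UNIV - {0}", OF this]
      bounded_rv_mult[OF b bounded_rv_affine_average[OF c]]
    note int = int[THEN bounded_rv_integrable]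
    show ?thesis
      by (simp only: Bochner_Integration.integral_diff[OF int(2) integrable_mult_right[OF int(3)]]
        Bochner_Integration.integral_sum[OF int(1)] integral_mult_right_zero)
  qed
  also have "(\<Sum>u\<in>UNIV-{0}. \<integral>x. ?b x * ?c (?h u x) \<partial>M) = 0"
    using null B C by (intro sum.neutral) (auto simp: measure_intersection_eq)
  finally have bD: "(\<integral>x. ?b x * D x \<partial>M) = - ((?q - 1) * (\<integral>x. ?b x * affine_average ?c x \<partial>M))"
    by simp
  have "(?q - 1) * (measure M B * measure M C) \<le> (?q - 1) * (\<integral>x. ?b x * affine_average ?c x \<partial>M)"
    using avg q by (intro mult_left_mono) auto
  with bD have bD': "(\<integral>x. ?b x * D x \<partial>M) \<le> - ((?q - 1) * (measure M B * measure M C))"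
    by simp
  have bb: "(\<integral>x. ?b x * ?b x \<partial>M) = measure M B"
    using B by (simp add: indicator_inter_arith[symmetric])
  have "0 \<le> (\<integral>x. (D x + t * ?b x)\<^sup>2 \<partial>M)" by simp
  also have "\<dots> = (\<integral>x. (D x)\<^sup>2 + (2 * t * (?b x * D x) + t\<^sup>2 * (?b x * ?b x)) \<partial>M)"
    by (intro Bochner_Integration.integral_cong refl) (simp add: power2_eq_square algebra_simps)
  also have "\<dots> = (\<integral>x. (D x)\<^sup>2 \<partial>M)
      + (2 * t * (\<integral>x. ?b x * D x \<partial>M) + t\<^sup>2 * (\<integral>x. ?b x * ?b x \<partial>M))"
  proof -
    have "integrable M (\<lambda>x. (D x)\<^sup>2)" "integrable M (\<lambda>x. ?b x * D x)" "integrable M (\<lambda>x. ?b x * ?b x)"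
      using b D by (auto intro!: bounded_rv_integrable bounded_rv_intros)
    then show ?thesis by simp
  qed
  also have "\<dots> \<le> (3 * ?q - 5) * measure M C
      + (2 * t * (- ((?q - 1) * (measure M B * measure M C))) + t\<^sup>2 * measure M B)"
    unfolding bb using DD bD' q by (intro add_mono mult_left_mono) (auto simp: t_def)
  \<comment> \<open>The value of \<open>t\<close> minimises the preceding quadratic in
    \<open>t\<close>; its last two terms sum to
    \<open>-(q - 1)^2 * measure M B * (measure M C)^2\<close>.\<close>
  also have "\<dots> = measure M C * (3 * ?q - 5 - (?q - 1)\<^sup>2 * (measure M B * measure M C))"
    by (simp add: t_def power2_eq_square algebra_simps)
  finally show ?thesis using pos by (simp add: zero_le_mult_iff)
qed

section \<open>Lower bounds for the correlation with the affine average\<close>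

text \<open>The affine average \<open>?P\<close> behaves as an orthogonal projection: the
  correlation equals the integral of \<open>?P^2\<close>, which is at least the square of the
  integral of \<open>?P\<close>, namely \<open>?m^2\<close>.\<close>

lemma measure_square_le_correlation_affine_average:
  assumes B: "B \<in> sets M"
  shows "measure M B * measure M B \<le> (\<integral>x. indicator B x * affine_average (indicator B) x \<partial>M)"
proof -
  let ?b = "indicator B :: 'a \<Rightarrow> real"
  let ?P = "affine_average ?b"
  let ?m = "measure M B"
  have b: "bounded_rv ?b" using B by (rule bounded_rv_indicator)
  note P = bounded_rv_affine_average[OF b]
  have bP: "bounded_rv (\<lambda>x. ?b x * ?P x)" by (rule bounded_rv_mult[OF b P])
  \<comment> \<open>The invariant factor \<open>?P\<close> can be pulled out of the average.\<close>
  have PP: "affine_average (\<lambda>x. ?b x * ?P x) x = (?P x)\<^sup>2" if x: "x \<in> space M" for x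
  proof -
    have "additive_average (\<lambda>x. ?b x * ?P x) y = additive_average ?b y * ?P y" if "y \<in> space M" for y
      using that by (simp add: additive_average_def affine_average_invariant sum_distrib_right)
    then have "(\<Sum>u\<in>UNIV-{0}. additive_average (\<lambda>x. ?b x * ?P x) (T (affine_map u 0) x))
      = (\<Sum>u\<in>UNIV-{0}. additive_average ?b (T (affine_map u 0) x) * ?P x)"
      using x by (intro sum.cong refl) (simp add: T_in_space affine_average_invariant)
    also have "\<dots> = (real CARD('f) - 1) * (?P x)\<^sup>2"
      using card_field_ge_2[where 'f='f]
      by (simp add: sum_distrib_right[symmetric] power2_eq_square)
        (simp add: affine_average_def[of ?b])
    finally show ?thesis
      unfolding affine_average_def[of "\<lambda>x. ?b x * ?P x"]
      using card_field_ge_2[where 'f='f] by simp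
  qed
  have int: "(\<integral>x. ?P x \<partial>M) = ?m" using B by (simp add: integral_affine_average b)
  \<comment> \<open>Nonnegativity of the variance of \<open>?P\<close> gives the Cauchy-Schwarz
    step.\<close>
  have "0 \<le> (\<integral>x. (?P x - ?m)\<^sup>2 \<partial>M)" by simp
  also have "\<dots> = (\<integral>x. (?P x)\<^sup>2 + (?m * ?m - 2 * ?m * ?P x) \<partial>M)"
    by (intro Bochner_Integration.integral_cong refl) (simp add: power2_eq_square algebra_simps)
  also have "\<dots> = (\<integral>x. (?P x)\<^sup>2 \<partial>M) - ?m * ?m"
    using P int prob_space by (simp add: bounded_rv_integrable bounded_rv_intros)
  also have "(\<integral>x. (?P x)\<^sup>2 \<partial>M) = (\<integral>x. affine_average (\<lambda>x. ?b x * ?P x) x \<partial>M)"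
    using PP by (intro Bochner_Integration.integral_cong refl) simp
  also have "\<dots> = (\<integral>x. ?b x * ?P x \<partial>M)" using bP by (rule integral_affine_average)
  finally show ?thesis by simp
qed

text \<open>It suffices that \<open>?P\<close> is almost everywhere at least its mean
  \<open>?m\<close>. The set where it is smaller is invariant, so it has measure 0 or 1, and measure
  1 would push the integral of \<open>?P\<close> below \<open>?m\<close>.\<close>

lemma measure_prod_le_correlation_affine_average:
  assumes erg: "ergodic_action affine_group M T" and B: "B \<in> sets M" and C: "C \<in> sets M"
  shows "measure M B * measure M C \<le> (\<integral>x. indicator B x * affine_average (indicator C) x \<partial>M)"
proof -
  let ?b = "indicator B :: 'a \<Rightarrow> real" and ?c = "indicator C :: 'a \<Rightarrow> real"
  let ?P = "affine_average ?c"
  let ?m = "measure M C"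
  have b: "bounded_rv ?b" and c: "bounded_rv ?c" using B C by (auto intro: bounded_rv_indicator)
  note P = bounded_rv_affine_average[OF c]
  have [measurable]: "?P \<in> borel_measurable M" using P by auto
  have int: "(\<integral>x. ?P x \<partial>M) = ?m" using C by (simp add: integral_affine_average c)
  \<comment> \<open>Since \<open>?P\<close> is invariant at every point of the space,
    \<open>S\<close> is strictly invariant, as \<open>ergodic_action\<close> demands.\<close>
  define S where "S = {x \<in> space M. ?P x < ?m}"
  have S: "S \<in> sets M" unfolding S_def by measurable
  have "T g ` S = S" if g: "g \<in> carrier affine_group" for g
  proof -
    obtain u v where "u \<noteq> 0" "g = affine_map u v"
      using g by (auto simp: affine_map_def elim: affine_groupE)
    then show ?thesis
      by (subst \<open>g = _\<close>, subst T_image_eq_vimage) (auto simp: S_def T_in_space affine_average_invariant)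
  qed
  then have "measure M S = 0 \<or> measure M S = 1"
    using erg S by (auto simp: ergodic_action_def)
  moreover have "measure M S \<noteq> 1"
  proof
    assume "measure M S = 1"
    then have "AE x in M. ?P x < ?m"
      using prob_eq_1[OF S] by (auto simp: S_def)
    then have "(\<integral>x. ?P x \<partial>M) < (\<integral>x. ?m \<partial>M)"
      using P by (intro integral_less_AE_space) (auto simp: bounded_rv_integrable emeasure_space_1)
    then show False using int prob_space by simp
  qed
  ultimately have "measure M S = 0" by simp
  then have "AE x in M. \<not> ?P x < ?m"
    using prob_eq_0[OF S] by (auto simp: S_def)
  then have "(\<integral>x. ?b x * ?m \<partial>M) \<le> (\<integral>x. ?b x * ?P x \<partial>M)"
    by (intro integral_mono_AE bounded_rv_integrable[OF bounded_rv_mult[OF b bounded_rv_const]]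
        bounded_rv_integrable[OF bounded_rv_mult[OF b P]])
      (auto elim!: eventually_mono intro!: mult_left_mono)
  then show ?thesis using B by simp
qed

end

section \<open>Recurrence from the numerical bounds\<close>

theorem theorem5p1:
  fixes M :: "'a measure"
    and T :: "('f::{field,finite} \<Rightarrow> 'f) \<Rightarrow> 'a \<Rightarrow> 'a"
  assumes "prob_space M"
    and "measure_preserving_action affine_group M T"
  shows "(\<forall>B\<in>sets M. measure M B > sqrt (6 / real CARD('f)) \<longrightarrow>
            (\<exists>u::'f. u \<noteq> 0 \<and>
              measure M (B \<inter> T (mult_map u) ` (T (add_map (- u)) ` B)) > 0))
       \<and> (ergodic_action affine_group M T \<longrightarrow>
            (\<forall>B\<in>sets M. \<forall>C\<in>sets M.
              measure M B * measure M C > 6 / real (card (UNIV - {0::'f})) \<longrightarrow>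
              (\<exists>u::'f. u \<noteq> 0 \<and>
                measure M (B \<inter> T (mult_map u) ` (T (add_map (- u)) ` C)) > 0)))"
proof -
  interpret affine_action M T
    using assms by (simp add: affine_action_def affine_action_axioms_def)
  let ?q = "real CARD('f)"
  let ?R = "\<lambda>B C. \<exists>u::'f. u \<noteq> 0 \<and> measure M (B \<inter> T (mult_map u) ` (T (add_map (- u)) ` C)) > 0"
  have q: "?q \<ge> 2" by (rule card_field_ge_2)
  have recurrence: "?R B C"
    if "B \<in> sets M" "C \<in> sets M"
      and "measure M B * measure M C \<le> (\<integral>x. indicator B x * affine_average (indicator C) x \<partial>M)"
      and "3 * ?q - 5 < (?q - 1)\<^sup>2 * (measure M B * measure M C)" for B C
    using measure_prod_le_if_null_intersections[of B C] that
    by (meson measure_nonneg not_le order_antisym_conv)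
  have "?R B B" if B: "B \<in> sets M" and large: "sqrt (6 / ?q) < measure M B" for B
  proof (rule recurrence[OF B B measure_square_le_correlation_affine_average[OF B]])
    have "(sqrt (6 / ?q))\<^sup>2 < (measure M B)\<^sup>2"
      using large by (intro power_strict_mono) auto
    then have "6 / ?q < measure M B * measure M B" by (simp add: power2_eq_square)
    then have "(?q - 1)\<^sup>2 * (6 / ?q) < (?q - 1)\<^sup>2 * (measure M B * measure M B)"
      using q by (intro mult_strict_left_mono) auto
    moreover have "3 * ?q - 5 \<le> (?q - 1)\<^sup>2 * (6 / ?q)"
    proof -
      \<comment> \<open>This is \<open>6 * (q - 1)^2 - (3 * q - 5) * q\<close> expanded around
        \<open>q = 2\<close>, the least possible cardinality, which makes every term
        nonnegative.\<close>
      have "0 \<le> 3 * (?q - 2)\<^sup>2 + 5 * (?q - 2) + 4"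
        using q by (intro add_nonneg_nonneg) auto
      then have "(3 * ?q - 5) * ?q \<le> 6 * (?q - 1)\<^sup>2"
        by (simp add: power2_eq_square algebra_simps)
      then show ?thesis using q by (simp add: field_simps)
    qed
    ultimately show "3 * ?q - 5 < (?q - 1)\<^sup>2 * (measure M B * measure M B)" by simp
  qed
  moreover have "?R B C"
    if erg: "ergodic_action affine_group M T" and B: "B \<in> sets M" and C: "C \<in> sets M"
      and large: "6 / real (card (UNIV - {0::'f})) < measure M B * measure M C" for B C
  proof (rule recurrence[OF B C measure_prod_le_correlation_affine_average[OF erg B C]])
    have "(?q - 1)\<^sup>2 * (6 / (?q - 1)) < (?q - 1)\<^sup>2 * (measure M B * measure M C)"
      using large q unfolding card_nonzero by (intro mult_strict_left_mono) auto
    \<comment> \<open>Here \<open>6 * (q - 1)\<close> exceeds \<open>3 * q - 5\<close> because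
      \<open>3 * q > 1\<close>.\<close>
    moreover have "(?q - 1)\<^sup>2 * (6 / (?q - 1)) = 6 * (?q - 1)"
      using q by (simp add: power2_eq_square)
    ultimately show "3 * ?q - 5 < (?q - 1)\<^sup>2 * (measure M B * measure M C)" using q by simp
  qed
  ultimately show ?thesis by (intro conjI ballI impI)
qed

end
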